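(* Let $0<\lambda\le\Lambda<\infty$, and let $\mathcal{M}^{\pm}_{\lambda,\Lambda}$ be the Pucci operators defined in the context. Assume that $V:\mathbf{R}\to\mathbf{R}$ satisfies $V\in W^{1,\infty}(\mathbf{R})$, $\inf_{\mathbf{R}}V>0$, $V'(x)\ge 0$ for a.a. $x\in\mathbf{R}$, and $$\lim_{x\to-\infty}V(x)<\lim_{x\to\infty}V(x).$$ Assume that $f\in C^1(\mathbf{R})$, $f(s)=0$ for all $s\le 0$, $s\mapsto s^{-1}f(s)$ is strictly increasing on $(0,\infty)$, and $$\lim_{s\to 0}\frac{f(s)}{s}=0.$$ Then neither of the two problems (one for the sign $+$, one for the sign $-$) $$-\mathcal{M}^{\pm}_{\lambda,\Lambda}(u'')+V(x)u=f(u)\ \text{ in }\mathbf{R},\qquad u>0\ \text{ in }\mathbf{R},\qquad \lim_{|x|\to\infty}u(x)=0$$ has a solution.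
   Context: For $0<\lambda\le\Lambda<\infty$ the Pucci operators are the functions on $\mathbf{R}$ given by $\mathcal{M}^+_{\lambda,\Lambda}(s)=\Lambda s$ if $s\ge 0$ and $\lambda s$ if $s<0$; $\mathcal{M}^-_{\lambda,\Lambda}(s)=\lambda s$ if $s\ge 0$ and $\Lambda s$ if $s<0$. Functions in $W^{1,\infty}(\mathbf{R})$ are identified with their bounded Lipschitz continuous representatives. A solution is a classical one: $u\in C^2(\mathbf{R})$ and the equation holds at every point. *)

theory Defs
  imports "HOL-Analysis.Analysis"
begin

definition pucci_plus :: "real \<Rightarrow> real \<Rightarrow> real \<Rightarrow> real" where
  "pucci_plus lam Lam s = (if s \<ge> 0 then Lam * s else lam * s)"

definition pucci_minus :: "real \<Rightarrow> real \<Rightarrow> real \<Rightarrow> real" where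
  "pucci_minus lam Lam s = (if s \<ge> 0 then lam * s else Lam * s)"

(* Elements of the Sobolev space are identified with their bounded Lipschitz
   continuous representatives. *)
definition W1_infinity :: "(real \<Rightarrow> real) set" where
  "W1_infinity = {V. bounded (range V) \<and> (\<exists>L. L-lipschitz_on UNIV V)}"

definition C2_on_reals :: "(real \<Rightarrow> real) \<Rightarrow> bool" where
  "C2_on_reals u \<longleftrightarrow> u C1_differentiable_on UNIV \<and> deriv u C1_differentiable_on UNIV"

(* The argument M is the Pucci operator.  For a real argument, at_infinity is
   the filter of the limit as the absolute value tends to infinity. *)
definition is_solution ::
  "(real \<Rightarrow> real) \<Rightarrow> (real \<Rightarrow> real) \<Rightarrow> (real \<Rightarrow> real) \<Rightarrow> (real \<Rightarrow> real) \<Rightarrow> bool" where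
  "is_solution M V f u \<longleftrightarrow>
     C2_on_reals u \<and>
     (\<forall>x. - M (deriv (deriv u) x) + V x * u x = f (u x)) \<and>
     (\<forall>x. u x > 0) \<and>
     (u \<longlongrightarrow> 0) at_infinity"

end

theory Submission
  imports Defs
begin

text \<open>
  With \<open>N\<close> the inverse of the Pucci operator, the equation reads \<open>u'' = N (V u - f u)\<close>, and \<open>N\<close> is
  increasing and bi-Lipschitz. Let \<open>G v s\<close> be the integral of \<open>N (v r - f r)\<close> over \<open>0 \<le> r \<le> s\<close> and
  consider the energy \<open>E x = (u' x)\<^sup>2 / 2 - G (V x) (u x)\<close>. Freezing the potential at \<open>V x\<close>
  changes the increment \<open>E y - E x\<close> by only \<open>O((y - x)\<^sup>2)\<close>, whereas \<open>G\<close> grows at least linearly in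
  \<open>v\<close>; hence \<open>E\<close> is nonincreasing, and strictly so across any interval on which the nondecreasing
  function \<open>V\<close> is not constant. But \<open>E\<close> vanishes at both ends of the line.
\<close>

section \<open>Monotonicity criteria and decay of derivatives on the real line\<close>

text \<open>Over \<open>Suc n\<close> equal pieces the quadratic bounds sum to
  \<open>C * (b - a)\<^sup>2 / real (Suc n)\<close>, which tends to 0. The criterion asks for no
  derivative of \<open>g\<close>; this suits the energy, which involves a potential that is only
  Lipschitz.\<close>

lemma le_of_quadratic_increments:
  fixes g :: "real \<Rightarrow> real"
  assumes "a \<le> b"
    and quad: "\<And>x y. a \<le> x \<Longrightarrow> x \<le> y \<Longrightarrow> y \<le> b \<Longrightarrow> g y - g x \<le> C * (y - x)\<^sup>2"
  shows "g b \<le> g a"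
proof -
  have bound: "g b - g a \<le> C * (b - a)\<^sup>2 / real (Suc n)" for n
  proof -
    define h where "h = (b - a) / real (Suc n)"
    have h0: "h \<ge> 0" and hn: "real (Suc n) * h = b - a"
      using \<open>a \<le> b\<close> by (simp_all add: h_def)
    have "g (a + real k * h) - g a \<le> real k * (C * h\<^sup>2)" if "k \<le> Suc n" for k
      using that
    proof (induction k)
      case (Suc k)
      have "real (Suc k) * h \<le> real (Suc n) * h"
        using Suc.prems h0 by (intro mult_right_mono) auto
      then have "g (a + real (Suc k) * h) - g (a + real k * h)
          \<le> C * ((a + real (Suc k) * h) - (a + real k * h))\<^sup>2"
        using h0 hn by (intro quad) (auto simp: algebra_simps)
      then show ?case using Suc by (simp add: algebra_simps)
    qed simp
    from this[of "Suc n"] have "g b - g a \<le> real (Suc n) * (C * h\<^sup>2)"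
      using hn by simp
    also have "\<dots> = C * (b - a)\<^sup>2 / real (Suc n)"
      by (simp add: h_def power2_eq_square)
    finally show ?thesis .
  qed
  have "(\<lambda>n. C * (b - a)\<^sup>2 / real (Suc n)) \<longlonglongrightarrow> 0"
    using LIMSEQ_Suc[OF lim_const_over_n[of "C * (b - a)\<^sup>2"]] by simp
  from LIMSEQ_le_const[OF this, of "g b - g a"] bound show ?thesis by auto
qed

lemma lipschitz_negligible_image:
  fixes g :: "real \<Rightarrow> real"
  assumes "L-lipschitz_on UNIV g" "negligible S"
  shows "negligible (g ` S)"
proof (rule negligible_locally_Lipschitz_image[OF _ \<open>negligible S\<close>])
  show "\<exists>T B. open T \<and> x \<in> T \<and> (\<forall>y\<in>S \<inter> T. norm (g y - g x) \<le> B * norm (y - x))" for x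
    using lipschitz_onD[OF assms(1)]
    by (intro exI[of _ UNIV] exI[of _ L]) (simp add: dist_norm)
qed simp

text \<open>If \<open>g\<close> had a strict descent, some level \<open>y\<close> in between would avoid the null set
  \<open>g ` S\<close>, and at the last point where \<open>g\<close> attains \<open>y\<close> the derivative could not be positive.\<close>

lemma lipschitz_mono_of_deriv_pos:
  fixes g :: "real \<Rightarrow> real"
  assumes lip: "L-lipschitz_on UNIV g" and null: "negligible S"
    and pos: "\<And>x. x \<notin> S \<Longrightarrow> \<exists>D>0. (g has_real_derivative D) (at x)"
    and "a \<le> b"
  shows "g a \<le> g b"
proof (rule ccontr)
  assume "\<not> g a \<le> g b"
  then have "g b < g a" by simp
  have "\<not> {g b<..<g a} \<subseteq> g ` S"
    using lipschitz_negligible_image[OF lip null] \<open>g b < g a\<close>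
    by (metis greaterThanLessThan_empty_iff negligible_subset not_le open_greaterThanLessThan
        open_not_negligible)
  then obtain y where "y \<in> {g b<..<g a}" "y \<notin> g ` S" by blast
  then have y: "g b < y" "y < g a" "y \<notin> g ` S" by simp_all
  have cont: "continuous_on UNIV g" using lip by (rule lipschitz_on_continuous_on)
  \<comment> \<open>With the superlevel set instead of the level set, \<open>g < y\<close> to the
    right of its maximum \<open>t\<close> is immediate; the intermediate value theorem then rules
    out \<open>y < g t\<close>.\<close>
  define T where "T = {a..b} \<inter> g -` {y..}"
  have "closed T"
    unfolding T_def
    by (intro continuous_closed_preimage continuous_on_subset[OF cont]) auto
  then have "compact T"
    unfolding T_def by (metis Int_lower1 bounded_closed_interval bounded_subset compact_eq_bounded_closed)
  moreover have "a \<in> T" using y \<open>a \<le> b\<close> by (simp add: T_def)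
  ultimately obtain t where t: "t \<in> T" and last: "\<And>s. s \<in> T \<Longrightarrow> s \<le> t"
    using compact_attains_sup[of T] by auto
  have below: "g s < y" if "t < s" "s \<le> b" for s
    using last[of s] that t by (force simp: T_def)
  have "t < b" using t y by (auto simp: T_def order_less_le)
  have "\<not> y < g t"
  proof
    assume "y < g t"
    have "\<exists>x\<ge>t. x \<le> b \<and> g x = y"
      using t y \<open>t < b\<close> \<open>y < g t\<close> cont
      by (intro IVT2') (auto intro: continuous_on_subset)
    then show False using below \<open>y < g t\<close> by force
  qed
  then have gt: "g t = y" using t by (auto simp: T_def)
  then have "t \<notin> S" using y by auto
  then obtain D where "D > 0" "(g has_real_derivative D) (at t)" using pos by blast
  then obtain d where "d > 0" and inc: "\<And>h. 0 < h \<Longrightarrow> h < d \<Longrightarrow> g t < g (t + h)"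
    using DERIV_pos_inc_right by blast
  define h where "h = min (d / 2) (b - t)"
  have "0 < h" "h < d" "t + h \<le> b" using \<open>d > 0\<close> \<open>t < b\<close> by (auto simp: h_def)
  then show False using inc[of h] below[of "t + h"] gt by simp
qed

text \<open>Adding a small linear term \<open>k * x\<close> makes the derivative strictly positive
  off the null set, so the previous lemma applies; the slope is then sent to 0.\<close>

lemma lipschitz_mono_of_deriv_nonneg:
  fixes g :: "real \<Rightarrow> real"
  assumes lip: "L-lipschitz_on UNIV g"
    and ae: "AE x in lebesgue. g differentiable (at x) \<and> deriv g x \<ge> 0"
  shows "mono g"
proof
  fix a b :: real assume "a \<le> b"
  define S where "S = {x. \<not> (g differentiable (at x) \<and> deriv g x \<ge> 0)}"
  have null: "negligible S"
    using ae unfolding S_def completion.AE_iff_null_sets negligible_iff_null_sets by simp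
  have "g a \<le> g b + e" if "e > 0" for e
  proof -
    \<comment> \<open>The slope costs at most \<open>e\<close> over the interval; the summand 1
      keeps the denominator positive when \<open>a = b\<close>.\<close>
    define k where "k = e / (b - a + 1)"
    have "k > 0" using \<open>a \<le> b\<close> \<open>e > 0\<close> by (simp add: k_def)
    have lip': "(L + k)-lipschitz_on UNIV (\<lambda>x. g x + k * x)"
    proof (rule lipschitz_on_add[OF lip])
      show "k-lipschitz_on UNIV (\<lambda>x. k * x)"
        using \<open>k > 0\<close>
        by (intro lipschitz_onI) (auto simp: dist_real_def abs_mult right_diff_distrib[symmetric])
    qed
    have "\<exists>D>0. ((\<lambda>x. g x + k * x) has_real_derivative D) (at x)" if "x \<notin> S" for x
    proof -
      have "(g has_real_derivative deriv g x) (at x)" "deriv g x \<ge> 0"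
        using that by (auto simp: S_def DERIV_deriv_iff_real_differentiable)
      then show ?thesis
        using \<open>k > 0\<close> by (intro exI[of _ "deriv g x + k"]) (auto intro!: derivative_eq_intros)
    qed
    from lipschitz_mono_of_deriv_pos[OF lip' null this \<open>a \<le> b\<close>]
    have "g a \<le> g b + k * (b - a)" by (simp add: algebra_simps)
    also have "k * (b - a) \<le> k * (b - a + 1)" using \<open>k > 0\<close> by simp
    also have "k * (b - a + 1) = e" using \<open>a \<le> b\<close> by (simp add: k_def)
    finally show ?thesis by simp
  qed
  then show "g a \<le> g b" by (rule field_le_epsilon)
qed

text \<open>On \<open>[x, x + 1]\<close> the mean value theorem yields a point \<open>z\<close>
  where \<open>w' z\<close> equals the small increment of \<open>w\<close>; a second application
  bounds \<open>w' z - w' x\<close> by a value of \<open>w''\<close>.\<close>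

lemma deriv_tendsto_0_at_infinity:
  fixes w :: "real \<Rightarrow> real"
  assumes w: "\<And>x. (w has_real_derivative w' x) (at x)"
    and w': "\<And>x. (w' has_real_derivative w'' x) (at x)"
    and lim: "(w \<longlongrightarrow> 0) at_infinity" "(w'' \<longlongrightarrow> 0) at_infinity"
  shows "(w' \<longlongrightarrow> 0) at_infinity"
proof (rule tendstoI)
  fix e :: real assume "e > 0"
  then have "0 < e / 4" by simp
  have "\<forall>\<^sub>F x in at_infinity. \<bar>w x\<bar> < e / 4 \<and> \<bar>w'' x\<bar> < e / 4"
    using tendstoD[OF lim(1) \<open>0 < e / 4\<close>] tendstoD[OF lim(2) \<open>0 < e / 4\<close>]
    by eventually_elim (auto simp: dist_real_def)
  then obtain B where B: "\<And>x. B \<le> \<bar>x\<bar> \<Longrightarrow> \<bar>w x\<bar> < e / 4 \<and> \<bar>w'' x\<bar> < e / 4"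
    by (auto simp: eventually_at_infinity)
  \<comment> \<open>The margin 1 keeps all of \<open>[x, x + 1]\<close> in the region where the
    bounds hold, also for negative \<open>x\<close>. Three terms below \<open>e / 4\<close> add up
    to less than \<open>e\<close>.\<close>
  have "\<bar>w' x\<bar> < e" if "\<bar>B\<bar> + 1 \<le> \<bar>x\<bar>" for x
  proof -
    have far: "B \<le> \<bar>z\<bar>" if "x \<le> z" "z \<le> x + 1" for z
      using that \<open>\<bar>B\<bar> + 1 \<le> \<bar>x\<bar>\<close> by linarith
    obtain z where z: "x < z" "z < x + 1" "w (x + 1) - w x = (x + 1 - x) * w' z"
      using MVT2[of x "x + 1" w w'] w by auto
    obtain q where q: "x < q" "q < z" "w' z - w' x = (z - x) * w'' q"
      using MVT2[of x z w' w''] w' z by auto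
    have "\<bar>w' z - w' x\<bar> \<le> 1 * \<bar>w'' q\<bar>"
      unfolding q abs_mult using z by (intro mult_right_mono) auto
    then show ?thesis
      using B[OF far, of x] B[OF far, of "x + 1"] B[OF far, of q] z q by auto
  qed
  then show "\<forall>\<^sub>F x in at_infinity. dist (w' x) 0 < e"
    by (auto simp: eventually_at_infinity dist_real_def intro!: exI[of _ "\<bar>B\<bar> + 1"])
qed

section \<open>The inverse Pucci operator, abstractly\<close>

text \<open>Covers both signs at once. The lower slope \<open>c\<close> produces the loss of energy,
  and the upper slope \<open>K\<close> controls the error of freezing the potential.\<close>

locale bilipschitz_increasing =
  fixes N :: "real \<Rightarrow> real" and c K :: real
  assumes c_pos: "0 < c"
    and N_zero: "N 0 = 0"
    and N_lower: "s \<le> t \<Longrightarrow> c * (t - s) \<le> N t - N s"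
    and N_upper: "s \<le> t \<Longrightarrow> N t - N s \<le> K * (t - s)"
begin

lemma N_diff_abs: "\<bar>N s - N t\<bar> \<le> K * \<bar>s - t\<bar>"
proof -
  have "\<bar>N t - N s\<bar> \<le> K * (t - s)" if "s \<le> t" for s t
  proof -
    have "0 \<le> c * (t - s)" using c_pos that by simp
    then show ?thesis using N_lower[OF that] N_upper[OF that] by linarith
  qed
  from this[of s t] this[of t s] show ?thesis
    by (cases "s \<le> t") (simp_all add: abs_minus_commute)
qed

lemma K_nonneg: "0 \<le> K"
  using N_diff_abs[of 1 0] by simp

lemma N_abs: "\<bar>N t\<bar> \<le> K * \<bar>t\<bar>"
  using N_diff_abs[of t 0] N_zero by simp

lemma continuous_on_N: "continuous_on S N"
proof -
  have "K-lipschitz_on S N"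
    using N_diff_abs K_nonneg by (intro lipschitz_onI) (auto simp: dist_real_def)
  then show ?thesis by (rule lipschitz_on_continuous_on)
qed

lemma continuous_on_N_comp:
  "continuous_on S g \<Longrightarrow> continuous_on S (\<lambda>x. N (g x))"
  by (rule continuous_on_compose2[OF continuous_on_N[of UNIV]]) auto

end

section \<open>The energy of a positive decaying solution\<close>

locale potential_ode = bilipschitz_increasing N c K
  for N :: "real \<Rightarrow> real" and c K :: real +
  fixes V f u u' :: "real \<Rightarrow> real" and L M :: real
  assumes V_lip: "L-lipschitz_on UNIV V"
    and V_mono: "mono V"
    and V_bounded: "\<bar>V x\<bar> \<le> M"
    and f_cont: "continuous_on UNIV f"
    and f_zero: "f 0 = 0"
    and u_deriv: "(u has_real_derivative u' x) (at x)"
    and u'_deriv: "(u' has_real_derivative N (V x * u x - f (u x))) (at x)"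
    and u_pos: "0 < u x"
    and u_lim: "(u \<longlongrightarrow> 0) at_infinity"
begin

text \<open>This is \<open>G\<close> of the overview. Only \<open>s \<ge> 0\<close> matters, as
  \<open>u\<close> is positive; for negative \<open>s\<close> the interval is empty and the value is
  0.\<close>

definition primitive :: "real \<Rightarrow> real \<Rightarrow> real" where
  "primitive v s = integral {0..s} (\<lambda>r. N (v * r - f r))"

definition energy :: "real \<Rightarrow> real" where
  "energy x = (u' x)\<^sup>2 / 2 - primitive (V x) (u x)"

lemma continuous_on_integrand: "continuous_on S (\<lambda>r. N (v * r - f r))"
  by (intro continuous_on_N_comp continuous_intros continuous_on_subset[OF f_cont]) auto

lemma primitive_deriv:
  assumes "0 < s"
  shows "(primitive v has_real_derivative N (v * s - f s)) (at s)"
proof -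
  have "(primitive v has_real_derivative N (v * s - f s)) (at s within {0..s + 1})"
    unfolding primitive_def[abs_def] using assms
    by (intro integral_has_real_derivative continuous_on_integrand) auto
  moreover have "at s within {0..s + 1} = at s"
    using assms by (intro at_within_interior) auto
  ultimately show ?thesis by simp
qed

text \<open>At each \<open>r\<close> the integrands differ by at least
  \<open>c * (w - v) * r\<close>, by the lower slope of \<open>N\<close>; integration gives the
  factor \<open>s\<^sup>2 / 2\<close>.\<close>

lemma primitive_diff:
  assumes "v \<le> w" "0 \<le> s"
  shows "c * (w - v) * (s\<^sup>2 / 2) \<le> primitive w s - primitive v s"
proof -
  have int: "(\<lambda>r. N (v * r - f r)) integrable_on {0..s}" for v
    by (intro integrable_continuous_real continuous_on_integrand)
  have lin: "((\<lambda>r. c * (w - v) * r) has_integral c * (w - v) * (s\<^sup>2 / 2)) {0..s}"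
    using has_integral_mult_right[OF ident_has_integral[OF \<open>0 \<le> s\<close>], of "c * (w - v)"] by simp
  have "c * (w - v) * (s\<^sup>2 / 2) \<le> integral {0..s} (\<lambda>r. N (w * r - f r) - N (v * r - f r))"
  proof (rule has_integral_le[OF lin integrable_integral[OF integrable_diff[OF int int]]])
    fix r assume "r \<in> {0..s}"
    then have "v * r - f r \<le> w * r - f r" using assms by (simp add: mult_right_mono)
    from N_lower[OF this]
    show "c * (w - v) * r \<le> N (w * r - f r) - N (v * r - f r)"
      by (simp add: algebra_simps)
  qed
  also have "\<dots> = primitive w s - primitive v s"
    unfolding primitive_def by (rule integral_diff[OF int int])
  finally show ?thesis .
qed

lemma continuous_u: "continuous_on S u"
  using u_deriv by (meson DERIV_isCont continuous_at_imp_continuous_on)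

lemma continuous_u': "continuous_on S u'"
  using u'_deriv by (meson DERIV_isCont continuous_at_imp_continuous_on)

lemma frozen_energy_increment:
  assumes "x \<le> y"
    and B: "\<And>t. x \<le> t \<Longrightarrow> t \<le> y \<Longrightarrow> \<bar>u' t * u t\<bar> \<le> B"
  shows "((u' y)\<^sup>2 / 2 - primitive (V x) (u y)) - ((u' x)\<^sup>2 / 2 - primitive (V x) (u x))
     \<le> B * K * L * (y - x)\<^sup>2"
proof (cases "x = y")
  case False
  then have "x < y" using assms by simp
  define h where "h t = (u' t)\<^sup>2 / 2 - primitive (V x) (u t)" for t
  define h' where "h' t = u' t * (N (V t * u t - f (u t)) - N (V x * u t - f (u t)))" for t
  have "(h has_real_derivative h' t) (at t)" for t
    unfolding h_def[abs_def] h'_def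
    using u_deriv[of t] u'_deriv[of t] DERIV_chain2[OF primitive_deriv[OF u_pos] u_deriv, of "V x" t]
    by (auto intro!: derivative_eq_intros simp: algebra_simps)
  then obtain z where z: "x < z" "z < y" "h y - h x = (y - x) * h' z"
    using MVT2[OF \<open>x < y\<close>, of h h'] by auto
  have L0: "0 \<le> L" using V_lip by (rule lipschitz_on_nonneg)
  have "\<bar>h' z\<bar> \<le> \<bar>u' z\<bar> * (K * (\<bar>V z - V x\<bar> * u z))"
    using N_diff_abs[of "V z * u z - f (u z)" "V x * u z - f (u z)"] u_pos[of z]
    by (simp add: h'_def abs_mult mult_left_mono left_diff_distrib[symmetric])
  also have "\<dots> = \<bar>u' z * u z\<bar> * (K * \<bar>V z - V x\<bar>)"
    using u_pos[of z] by (simp add: abs_mult)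
  also have "\<dots> \<le> B * (K * (L * (y - x)))"
  proof (intro mult_mono)
    show "\<bar>V z - V x\<bar> \<le> L * (y - x)"
      using lipschitz_onD[OF V_lip, of z x] z L0
      by (auto simp: dist_real_def intro: order_trans[OF _ mult_left_mono])
  qed (use B[of z] z K_nonneg in auto)
  finally have "h' z \<le> B * (K * (L * (y - x)))" by simp
  then have "(y - x) * h' z \<le> (y - x) * (B * (K * (L * (y - x))))"
    using \<open>x < y\<close> by (intro mult_left_mono) auto
  then show ?thesis using z by (simp add: h_def power2_eq_square mult_ac)
qed simp

lemma energy_drop:
  assumes "x \<le> y"
  shows "\<exists>d>0. energy y + d * (V y - V x) \<le> energy x"
proof -
  have "compact ((\<lambda>t. u' t * u t) ` {x..y})"
    by (intro compact_continuous_image continuous_intros continuous_u continuous_u') simp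
  then obtain B where B: "\<And>t. x \<le> t \<Longrightarrow> t \<le> y \<Longrightarrow> \<bar>u' t * u t\<bar> \<le> B"
    by (fastforce dest!: compact_imp_bounded simp: bounded_iff)
  obtain p where p: "p \<in> {x..y}" "\<And>t. t \<in> {x..y} \<Longrightarrow> u p \<le> u t"
    using continuous_attains_inf[OF _ _ continuous_u, of "{x..y}"] assms by auto
  \<comment> \<open>The positive minimum of \<open>u\<close> on the compact interval makes one
    \<open>d\<close> serve all subintervals.\<close>
  define d where "d = c * ((u p)\<^sup>2 / 2)"
  have "d > 0" using c_pos u_pos[of p] by (simp add: d_def)
  have "energy y + d * V y \<le> energy x + d * V x"
  proof (rule le_of_quadratic_increments[OF assms])
    fix s t assume st: "x \<le> s" "s \<le> t" "t \<le> y"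
    have Vst: "V s \<le> V t" using V_mono st by (simp add: monoD)
    have "(u p)\<^sup>2 \<le> (u t)\<^sup>2" using p st u_pos[of p] by (intro power_mono) auto
    then have "d * (V t - V s) \<le> c * (V t - V s) * ((u t)\<^sup>2 / 2)"
      using c_pos Vst by (simp add: d_def mult_left_mono mult.commute mult.left_commute)
    also have "\<dots> \<le> primitive (V t) (u t) - primitive (V s) (u t)"
      using Vst u_pos[of t] by (intro primitive_diff) auto
    finally have "d * (V t - V s) \<le> primitive (V t) (u t) - primitive (V s) (u t)" .
    with frozen_energy_increment[of s t B] B st
    show "(energy t + d * V t) - (energy s + d * V s) \<le> B * K * L * (t - s)\<^sup>2"
      by (simp add: energy_def algebra_simps)
  qed
  with \<open>d > 0\<close> show ?thesis by (intro exI[of _ d]) (auto simp: algebra_simps)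
qed

text \<open>The decay of \<open>u\<close> passes through the equation to the second derivative, and
  from both to \<open>u'\<close>. The remaining term is bounded by a multiple of
  \<open>u\<close>.\<close>

lemma energy_lim: "(energy \<longlongrightarrow> 0) at_infinity"
proof -
  have f_lim: "((\<lambda>x. f (u x)) \<longlongrightarrow> 0) at_infinity"
    using continuous_on_tendsto_compose[OF f_cont u_lim] f_zero by simp
  have "((\<lambda>x. V x * u x) \<longlongrightarrow> 0) at_infinity"
  proof (rule Lim_null_comparison)
    show "((\<lambda>x. M * u x) \<longlongrightarrow> 0) at_infinity"
      using tendsto_mult_right_zero[OF u_lim] .
    show "\<forall>\<^sub>F x in at_infinity. norm (V x * u x) \<le> M * u x"
      using V_bounded u_pos by (simp add: abs_mult order_less_imp_le mult_right_mono)
  qed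
  then have "((\<lambda>x. V x * u x - f (u x)) \<longlongrightarrow> 0) at_infinity"
    using tendsto_diff[OF _ f_lim] by fastforce
  then have "((\<lambda>x. N (V x * u x - f (u x))) \<longlongrightarrow> 0) at_infinity"
    using continuous_on_tendsto_compose[OF continuous_on_N[of UNIV]] N_zero by fastforce
  then have u'_lim: "(u' \<longlongrightarrow> 0) at_infinity"
    by (rule deriv_tendsto_0_at_infinity[OF u_deriv u'_deriv u_lim])
  have "compact (f ` {0..1})"
    by (intro compact_continuous_image continuous_on_subset[OF f_cont]) auto
  then obtain F where F: "\<And>r. 0 \<le> r \<Longrightarrow> r \<le> 1 \<Longrightarrow> \<bar>f r\<bar> \<le> F"
    by (fastforce dest!: compact_imp_bounded simp: bounded_iff)
  \<comment> \<open>Since \<open>u < 1\<close> far out, bounds for \<open>f\<close> on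
    \<open>[0, 1]\<close> and for \<open>V\<close> give a constant independent of
    \<open>x\<close>.\<close>
  have prim: "\<bar>primitive (V x) s\<bar> \<le> K * (M + F) * s" if "0 \<le> s" "s \<le> 1" for x s
  proof -
    have "norm (integral {0..s} (\<lambda>r. N (V x * r - f r))) \<le> K * (M + F) * (s - 0)"
    proof (rule integral_bound[OF \<open>0 \<le> s\<close> continuous_on_integrand])
      fix r assume r: "r \<in> {0..s}"
      have "\<bar>V x * r\<bar> \<le> M * 1"
        unfolding abs_mult using r that V_bounded[of x] by (intro mult_mono) auto
      then have "\<bar>V x * r - f r\<bar> \<le> M + F" using F[of r] r that by auto
      then show "norm (N (V x * r - f r)) \<le> K * (M + F)"
        using N_abs[of "V x * r - f r"] K_nonneg
        by (metis mult_left_mono order_trans real_norm_def)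
    qed
    then show ?thesis by (simp add: primitive_def)
  qed
  have "((\<lambda>x. primitive (V x) (u x)) \<longlongrightarrow> 0) at_infinity"
  proof (rule Lim_null_comparison)
    show "((\<lambda>x. K * (M + F) * u x) \<longlongrightarrow> 0) at_infinity"
      using tendsto_mult_right_zero[OF u_lim] .
    have "\<forall>\<^sub>F x in at_infinity. u x < 1" using order_tendstoD(2)[OF u_lim] by simp
    then show "\<forall>\<^sub>F x in at_infinity. norm (primitive (V x) (u x)) \<le> K * (M + F) * u x"
      by eventually_elim (use prim u_pos in \<open>auto simp: order_less_imp_le\<close>)
  qed
  from tendsto_diff[OF tendsto_divide[OF tendsto_power[OF u'_lim, of 2] tendsto_const[of 2]] this]
  show ?thesis by (simp add: energy_def[abs_def])
qed

text \<open>A nonincreasing energy with limit 0 at both ends satisfies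
  \<open>energy x \<le> 0 \<le> energy y\<close>, which leaves no room for the drop.\<close>

lemma potential_constant:
  assumes "x \<le> y"
  shows "V x = V y"
proof -
  have anti: "energy t \<le> energy s" if "s \<le> t" for s t
  proof -
    obtain d where "d > 0" "energy t + d * (V t - V s) \<le> energy s"
      using energy_drop[OF \<open>s \<le> t\<close>] by blast
    moreover have "0 \<le> d * (V t - V s)"
      using \<open>d > 0\<close> V_mono that by (simp add: monoD)
    ultimately show ?thesis by simp
  qed
  have "0 \<le> energy y"
    by (rule tendsto_upperbound[OF tendsto_mono[OF at_top_le_at_infinity energy_lim]])
      (auto intro: eventually_mono[OF eventually_ge_at_top[of y]] anti)
  moreover have "energy x \<le> 0"
    by (rule tendsto_lowerbound[OF tendsto_mono[OF at_bot_le_at_infinity energy_lim]])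
      (auto intro: eventually_mono[OF eventually_le_at_bot[of x]] anti)
  moreover obtain d where "d > 0" "energy y + d * (V y - V x) \<le> energy x"
    using energy_drop[OF assms] by blast
  ultimately have "d * (V y - V x) \<le> 0" by simp
  then have "V y \<le> V x" using \<open>d > 0\<close> by (simp add: mult_le_0_iff)
  with V_mono assms show ?thesis by (simp add: antisym monoD)
qed

end

section \<open>The Pucci operators and the nonexistence theorem\<close>

text \<open>Both pieces vanish at 0, so an increment across 0 splits there into two, each with one
  of the slopes \<open>p\<close> and \<open>q\<close>.\<close>

lemma bilipschitz_increasing_piecewise_linear:
  assumes "0 < p" "0 < q"
  shows "bilipschitz_increasing (\<lambda>t. if 0 \<le> t then p * t else q * t) (min p q) (max p q)"
proof
  fix s t :: real assume "s \<le> t"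
  have low: "min p q * z \<le> p * z" "min p q * z \<le> q * z"
    and up: "p * z \<le> max p q * z" "q * z \<le> max p q * z" if "0 \<le> z" for z
    using that by (simp_all add: mult_right_mono)
  consider "0 \<le> s" | "t < 0" | "s < 0" "0 \<le> t" by linarith
  then have "min p q * (t - s) \<le> (if 0 \<le> t then p * t else q * t) - (if 0 \<le> s then p * s else q * s) \<and>
    (if 0 \<le> t then p * t else q * t) - (if 0 \<le> s then p * s else q * s) \<le> max p q * (t - s)"
  proof cases
    case 1
    then show ?thesis using low[of "t - s"] up[of "t - s"] \<open>s \<le> t\<close> by (simp add: right_diff_distrib)
  next
    case 2
    then show ?thesis using low[of "t - s"] up[of "t - s"] \<open>s \<le> t\<close> by (simp add: right_diff_distrib)
  next
    case 3
    then have "q * s \<le> min p q * s" "max p q * s \<le> q * s"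
      by (auto intro: mult_right_mono_neg)
    moreover have "min p q * t \<le> p * t" "p * t \<le> max p q * t"
      using low(1) up(1) 3 by simp_all
    ultimately have "min p q * (t - s) \<le> p * t - q * s" "p * t - q * s \<le> max p q * (t - s)"
      unfolding right_diff_distrib by linarith+
    then show ?thesis using 3 by simp
  qed
  then show "min p q * (t - s) \<le> (if 0 \<le> t then p * t else q * t) - (if 0 \<le> s then p * s else q * s)"
    and "(if 0 \<le> t then p * t else q * t) - (if 0 \<le> s then p * s else q * s) \<le> max p q * (t - s)"
    by auto
qed (use assms in auto)

text \<open>The operator preserves signs, so inverting it means taking the reciprocal slope on each
  half-line.\<close>

lemma pucci_plus_inverse:
  assumes "0 < lam" "0 < Lam" "pucci_plus lam Lam s = t"
  shows "s = (if 0 \<le> t then 1 / Lam * t else 1 / lam * t)"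
  using assms by (auto simp: pucci_plus_def zero_le_mult_iff split: if_splits)

lemma pucci_minus_inverse:
  assumes "0 < lam" "0 < Lam" "pucci_minus lam Lam s = t"
  shows "s = (if 0 \<le> t then 1 / lam * t else 1 / Lam * t)"
  using assms by (auto simp: pucci_minus_def zero_le_mult_iff split: if_splits)

lemma C1_differentiable_on_UNIV_has_deriv:
  fixes g :: "real \<Rightarrow> real"
  assumes "g C1_differentiable_on UNIV"
  shows "(g has_real_derivative deriv g x) (at x)"
  using assms by (simp add: C1_differentiable_on_eq DERIV_deriv_iff_real_differentiable)

text \<open>The choice of sign enters only through \<open>P\<close> and its left inverse
  \<open>N\<close>; solving for the second derivative puts the problem into the setting of
  \<open>potential_ode\<close>.\<close>

lemma solution_potential_constant:
  fixes V f u P :: "real \<Rightarrow> real"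
  assumes N: "bilipschitz_increasing N c K"
    and inverse: "\<And>s t. P s = t \<Longrightarrow> s = N t"
    and V: "V \<in> W1_infinity" "AE x in lebesgue. V differentiable (at x) \<and> deriv V x \<ge> 0"
    and f: "f C1_differentiable_on UNIV" "f 0 = 0"
    and sol: "is_solution P V f u"
    and "x \<le> y"
  shows "V x = V y"
proof -
  obtain L where L: "L-lipschitz_on UNIV V" using V(1) by (auto simp: W1_infinity_def)
  obtain M where M: "\<And>x. \<bar>V x\<bar> \<le> M" using V(1) by (auto simp: W1_infinity_def bounded_iff)
  have C2: "u C1_differentiable_on UNIV" "deriv u C1_differentiable_on UNIV"
    using sol by (auto simp: is_solution_def C2_on_reals_def)
  have eq: "deriv (deriv u) x = N (V x * u x - f (u x))" for x
  proof (rule inverse)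
    have "- P (deriv (deriv u) x) + V x * u x = f (u x)"
      using sol by (simp add: is_solution_def)
    then show "P (deriv (deriv u) x) = V x * u x - f (u x)" by simp
  qed
  interpret bilipschitz_increasing N c K by (rule N)
  interpret potential_ode N c K V f u "deriv u" L M
  proof
    show "continuous_on UNIV f"
      using C1_differentiable_on_UNIV_has_deriv[OF f(1)]
      by (meson DERIV_isCont continuous_at_imp_continuous_on)
    show "(deriv u has_real_derivative N (V x * u x - f (u x))) (at x)" for x
      using C1_differentiable_on_UNIV_has_deriv[OF C2(2), of x] eq by simp
  qed (use L M f sol lipschitz_mono_of_deriv_nonneg[OF L V(2)]
      C1_differentiable_on_UNIV_has_deriv[OF C2(1)] in \<open>auto simp: is_solution_def\<close>)
  show ?thesis using \<open>x \<le> y\<close> by (rule potential_constant)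
qed

theorem theorem1p2:
  fixes lam Lam a b :: real and V f :: "real \<Rightarrow> real"
  assumes "0 < lam" and "lam \<le> Lam"
    and "V \<in> W1_infinity"
    and "(INF x. V x) > 0"
    and "AE x in lebesgue. V differentiable (at x) \<and> deriv V x \<ge> 0"
    and "(V \<longlongrightarrow> a) at_bot" and "(V \<longlongrightarrow> b) at_top" and "a < b"
    and "f C1_differentiable_on UNIV"
    and "\<And>s. s \<le> 0 \<Longrightarrow> f s = 0"
    and "strict_mono_on {0<..} (\<lambda>s. f s / s)"
    and "((\<lambda>s. f s / s) \<longlongrightarrow> 0) (at 0)"
  shows "\<not> (\<exists>u. is_solution (pucci_plus lam Lam) V f u) \<and>
         \<not> (\<exists>u. is_solution (pucci_minus lam Lam) V f u)"
proof -
  have "0 < Lam" using assms(1,2) by simp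
  \<comment> \<open>A constant potential would have equal limits at both ends, against
    \<open>a < b\<close>.\<close>
  have not_const: "\<not> (\<forall>x y. x \<le> y \<longrightarrow> V x = V y)"
  proof
    assume "\<forall>x y. x \<le> y \<longrightarrow> V x = V y"
    then have "V = (\<lambda>_. V 0)" by (metis linear)
    then have "(V \<longlongrightarrow> V 0) at_bot" "(V \<longlongrightarrow> V 0) at_top" by (metis tendsto_const)+
    then have "a = V 0" "b = V 0"
      using tendsto_unique[OF trivial_limit_at_bot_linorder assms(6)]
        tendsto_unique[OF trivial_limit_at_top_linorder assms(7)] by blast+
    then show False using \<open>a < b\<close> by simp
  qed
  have plus: "bilipschitz_increasing (\<lambda>t. if 0 \<le> t then 1 / Lam * t else 1 / lam * t)
      (min (1 / Lam) (1 / lam)) (max (1 / Lam) (1 / lam))"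
    and minus: "bilipschitz_increasing (\<lambda>t. if 0 \<le> t then 1 / lam * t else 1 / Lam * t)
      (min (1 / lam) (1 / Lam)) (max (1 / lam) (1 / Lam))"
    using \<open>0 < lam\<close> \<open>0 < Lam\<close> by (intro bilipschitz_increasing_piecewise_linear; simp)+
  have "f 0 = 0" using assms(10) by simp
  note const = solution_potential_constant[OF _ _ assms(3,5,9) \<open>f 0 = 0\<close>]
  have "\<not> is_solution (pucci_plus lam Lam) V f u" for u
    using const[OF plus pucci_plus_inverse[OF \<open>0 < lam\<close> \<open>0 < Lam\<close>]] not_const by blast
  moreover have "\<not> is_solution (pucci_minus lam Lam) V f u" for u
    using const[OF minus pucci_minus_inverse[OF \<open>0 < lam\<close> \<open>0 < Lam\<close>]] not_const by blast
  ultimately show ?thesis by blast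
qed

end
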